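(* Let $E$ be a Dedekind complete vector lattice with the countable sup property and a weak order unit. Suppose that $E$ admits a (necessarily unique) Hausdorff uo-Lebesgue topology $\widehat\tau_E$. Let $F$ be a vector sublattice of $E$. Then $$\overline{F}^{\widehat\tau_E}=a_{\sigma\mathrm{uo}}(F)=a_{\mathrm{uo}}(F)$$ in $E$.
   Context: All vector lattices are real and Archimedean. $E$ has the countable sup property if every non-empty subset of $E$ that has a supremum contains an at most countable subset with the same supremum. A weak order unit is an element that generates the whole of $E$ as a band. In $E$, a net $(x_\alpha)_{\alpha\in A}$ is order convergent to $x$ ($x_\alpha\xrightarrow{\mathrm{o}}x$) if there is a net $(y_\beta)_{\beta\in B}$ in $E$ with $y_\beta\downarrow 0$ such that for every $\beta_0\in B$ there is $\alpha_0\in A$ with $|x-x_\alpha|\le y_{\beta_0}$ for all $\alpha\ge\alpha_0$; it is unbounded order convergent to $x$ ($x_\alpha\xrightarrow{\mathrm{uo}}x$) if $|x_\alpha-x|\wedge y\xrightarrow{\mathrm{o}}0$ for all $y\in E^+$. A uo-Lebesgue topology on $E$ is a locally solid linear topology $\tau$ on $E$ such that $x_\alpha\xrightarrow{\mathrm{uo}}0$ implies $x_\alpha\xrightarrow{\tau}0$ for every net; $E$ admits at most one Hausdorff one, denoted $\widehat\tau_E$. For $S\subseteq E$, $a_{\mathrm{uo}}(S)$ (resp. $a_{\sigma\mathrm{uo}}(S)$) is the set of all $x\in E$ for which there is a net (resp. a sequence) in $S$ that is unbounded order convergent to $x$ in $E$. $\overline{S}^{\tau}$ is the closure of $S$ in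 the topology $\tau$. *)

theory Defs
  imports "HOL-Analysis.Analysis" "HOL-Library.Lattice_Algebras" "HOL-Library.Lub_Glb"
begin

section \<open>Vector lattices\<close>

text \<open>All vector lattices are real and Archimedean. Dedekind completeness is expressed by the
  additional class \<open>conditionally_complete_lattice\<close>.\<close>

class vector_lattice = ordered_real_vector + lattice_ab_group_add_abs +
  assumes archimedean: "0 \<le> x \<Longrightarrow> (\<And>n::nat. real n *\<^sub>R x \<le> y) \<Longrightarrow> x = 0"

definition countable_sup_property :: "'a::vector_lattice itself \<Rightarrow> bool" where
  "countable_sup_property _ \<longleftrightarrow>
     (\<forall>(S::'a set) s. S \<noteq> {} \<and> isLub UNIV S s \<longrightarrow>
        (\<exists>C\<subseteq>S. countable C \<and> isLub UNIV C s))"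

definition solid :: "'a::vector_lattice set \<Rightarrow> bool" where
  "solid S \<longleftrightarrow> (\<forall>y\<in>S. \<forall>x. \<bar>x\<bar> \<le> \<bar>y\<bar> \<longrightarrow> x \<in> S)"

definition band :: "'a::vector_lattice set \<Rightarrow> bool" where
  "band B \<longleftrightarrow> subspace B \<and> solid B \<and> (\<forall>S\<subseteq>B. \<forall>s. S \<noteq> {} \<and> isLub UNIV S s \<longrightarrow> s \<in> B)"

definition weak_order_unit :: "'a::vector_lattice \<Rightarrow> bool" where
  "weak_order_unit e \<longleftrightarrow> band hull {e} = UNIV"

definition vector_sublattice :: "'a::vector_lattice set \<Rightarrow> bool" where
  "vector_sublattice F \<longleftrightarrow> subspace F \<and> (\<forall>x\<in>F. \<forall>y\<in>F. sup x y \<in> F \<and> inf x y \<in> F)"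


section \<open>Nets\<close>

definition directed_set :: "'i set \<Rightarrow> 'i rel \<Rightarrow> bool" where
  "directed_set A r \<longleftrightarrow> preorder_on A r \<and> A \<noteq> {} \<and>
     (\<forall>a\<in>A. \<forall>b\<in>A. \<exists>c\<in>A. (a, c) \<in> r \<and> (b, c) \<in> r)"

definition tails :: "'i set \<Rightarrow> 'i rel \<Rightarrow> 'i filter" where
  "tails A r = (INF a\<in>A. principal {b. (a, b) \<in> r})"

text \<open>A quantifier over all nets in \<open>'a\<close> cannot range over all index types inside a
  definition, so there it ranges over the directed sets carried by subsets of the type below.
  This loses nothing. By \<open>net_canonical\<close>, every net, on whatever index type, can be
  replaced by one indexed by a subset of this type which has its values among those of the given
  net and the same filter of tails; \<open>a_uoI\<close> and \<open>uo_Lebesgue_topologyD\<close> draw the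
  consequences. Similarly, \<open>order_convergentI\<close> admits dominating nets of any index type.\<close>

type_synonym 'a net_index = "'a set \<times> 'a"

definition decreases_to :: "'i set \<Rightarrow> 'i rel \<Rightarrow> ('i \<Rightarrow> 'a::vector_lattice) \<Rightarrow> 'a \<Rightarrow> bool" where
  "decreases_to B s y l \<longleftrightarrow> directed_set B s \<and>
     (\<forall>(b, b')\<in>s. y b' \<le> y b) \<and> isGlb UNIV (y ` B) l"

definition order_convergent ::
  "'i set \<Rightarrow> 'i rel \<Rightarrow> ('i \<Rightarrow> 'a::vector_lattice) \<Rightarrow> 'a \<Rightarrow> bool" where
  "order_convergent A r x l \<longleftrightarrow>
     (\<exists>(B :: 'a net_index set) s y. decreases_to B s y 0 \<and>
        (\<forall>b\<^sub>0\<in>B. \<exists>a\<^sub>0\<in>A. \<forall>a. (a\<^sub>0, a) \<in> r \<longrightarrow> \<bar>l - x a\<bar> \<le> y b\<^sub>0))"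

definition uo_convergent ::
  "'i set \<Rightarrow> 'i rel \<Rightarrow> ('i \<Rightarrow> 'a::vector_lattice) \<Rightarrow> 'a \<Rightarrow> bool" where
  "uo_convergent A r x l \<longleftrightarrow> (\<forall>y\<ge>0. order_convergent A r (\<lambda>a. inf \<bar>x a - l\<bar> y) 0)"

definition a_uo :: "'a::vector_lattice set \<Rightarrow> 'a set" where
  "a_uo S = {l. \<exists>(A :: 'a net_index set) r x.
     directed_set A r \<and> x ` A \<subseteq> S \<and> uo_convergent A r x l}"

definition a_sigma_uo :: "'a::vector_lattice set \<Rightarrow> 'a set" where
  "a_sigma_uo S = {l. \<exists>x :: nat \<Rightarrow> 'a.
     range x \<subseteq> S \<and> uo_convergent UNIV {(m, n). m \<le> n} x l}"


section \<open>Topologies on a vector lattice\<close>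

definition linear_topology :: "'a::real_vector topology \<Rightarrow> bool" where
  "linear_topology T \<longleftrightarrow> topspace T = UNIV \<and>
     continuous_map (prod_topology T T) T (\<lambda>(x, y). x + y) \<and>
     continuous_map (prod_topology euclideanreal T) T (\<lambda>(c, x). c *\<^sub>R x)"

text \<open>Locally solid: the solid (not necessarily open) neighbourhoods of zero form a
  neighbourhood base at zero.\<close>

definition locally_solid :: "'a::vector_lattice topology \<Rightarrow> bool" where
  "locally_solid T \<longleftrightarrow>
     (\<forall>U. openin T U \<and> 0 \<in> U \<longrightarrow>
        (\<exists>V W. openin T W \<and> 0 \<in> W \<and> W \<subseteq> V \<and> solid V \<and> V \<subseteq> U))"

definition uo_Lebesgue_topology :: "'a::vector_lattice topology \<Rightarrow> bool" where
  "uo_Lebesgue_topology T \<longleftrightarrow> linear_topology T \<and> locally_solid T \<and>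
     (\<forall>(A :: 'a net_index set) r x.
        directed_set A r \<and> uo_convergent A r x 0 \<longrightarrow> limitin T x 0 (tails A r))"


section \<open>Independence of the index type\<close>

lemma eventually_tails:
  assumes "directed_set A r"
  shows "eventually P (tails A r) \<longleftrightarrow> (\<exists>a\<in>A. \<forall>b. (a, b) \<in> r \<longrightarrow> P b)"
proof -
  have "eventually P (tails A r) \<longleftrightarrow> (\<exists>a\<in>A. eventually P (principal {b. (a, b) \<in> r}))"
    unfolding tails_def
  proof (rule eventually_INF_base)
    show "A \<noteq> {}" using assms by (simp add: directed_set_def)
    fix a b assume "a \<in> A" "b \<in> A"
    then obtain c where "c \<in> A" "(a, c) \<in> r" "(b, c) \<in> r"
      using assms by (auto simp: directed_set_def)
    moreover have "trans r"
      using assms by (auto simp: directed_set_def preorder_on_def)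
    ultimately show "\<exists>c\<in>A. principal {b. (c, b) \<in> r}
        \<le> inf (principal {b. (a, b) \<in> r}) (principal {c. (b, c) \<in> r})"
      by (intro bexI[of _ c]) (auto dest: transD)
  qed
  then show ?thesis by (simp add: eventually_principal)
qed

lemma tails_sequence: "tails (UNIV :: nat set) {(m, n). m \<le> n} = sequentially"
  by (simp add: tails_def at_top_def atLeast_def)

lemma net_canonical:
  fixes x :: "'i \<Rightarrow> 'b"
  assumes dir: "directed_set A r"
  obtains B s and z :: "'b net_index \<Rightarrow> 'b"
  where "directed_set B s" "z ` B \<subseteq> x ` A"
    "filtermap z (tails B s) = filtermap x (tails A r)"
proof -
  define T where "T a = x ` {b. (a, b) \<in> r}" for a
  define B where "B = (\<Union>a\<in>A. {T a} \<times> T a)"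
  define s where "s = {(p, q). p \<in> B \<and> q \<in> B \<and> fst q \<subseteq> fst p}"
  have sub: "r \<subseteq> A \<times> A" and refl: "\<And>a. a \<in> A \<Longrightarrow> (a, a) \<in> r" and tr: "trans r"
    and ne: "A \<noteq> {}"
    and ub: "\<And>a b. a \<in> A \<Longrightarrow> b \<in> A \<Longrightarrow> \<exists>c\<in>A. (a, c) \<in> r \<and> (b, c) \<in> r"
    using dir by (auto simp: directed_set_def preorder_on_def refl_on_def)
  have T_mono: "T b \<subseteq> T a" if "(a, b) \<in> r" for a b
    using that tr by (auto simp: T_def dest: transD)
  have T_self: "x a \<in> T a" if "a \<in> A" for a
    using refl[OF that] by (auto simp: T_def)
  have B_I: "(T a, u) \<in> B" if "a \<in> A" "u \<in> T a" for a u
    using that by (auto simp: B_def)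
  have dirB: "directed_set B s"
    unfolding directed_set_def
  proof (intro conjI ballI)
    show "preorder_on B s"
      by (auto simp: preorder_on_def s_def refl_on_def trans_def)
    show "B \<noteq> {}"
      using ne B_I T_self by blast
    fix p q assume "p \<in> B" "q \<in> B"
    then obtain a b where ab: "a \<in> A" "b \<in> A" "fst p = T a" "fst q = T b"
      by (auto simp: B_def)
    obtain c where c: "c \<in> A" "(a, c) \<in> r" "(b, c) \<in> r"
      using ub ab by blast
    have "(T c, x c) \<in> B" using B_I T_self c(1) by blast
    then show "\<exists>c\<in>B. (p, c) \<in> s \<and> (q, c) \<in> s"
      using \<open>p \<in> B\<close> \<open>q \<in> B\<close> ab c T_mono
      by (intro bexI[of _ "(T c, x c)"]) (auto simp: s_def)
  qed
  have "filtermap snd (tails B s) = filtermap x (tails A r)"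
  proof (rule filter_eq_iff[THEN iffD2], intro allI)
    fix P
    have "(\<exists>p\<in>B. \<forall>q. (p, q) \<in> s \<longrightarrow> P (snd q)) \<longleftrightarrow> (\<exists>a\<in>A. \<forall>b. (a, b) \<in> r \<longrightarrow> P (x b))"
    proof
      assume "\<exists>p\<in>B. \<forall>q. (p, q) \<in> s \<longrightarrow> P (snd q)"
      then obtain p where p: "p \<in> B" "\<And>q. (p, q) \<in> s \<Longrightarrow> P (snd q)" by blast
      then obtain a where a: "a \<in> A" "fst p = T a" by (auto simp: B_def)
      have "P (x b)" if "(a, b) \<in> r" for b
        using p(2)[of "(T a, x b)"] B_I[of a "x b"] a p(1) that
        by (auto simp: s_def T_def)
      then show "\<exists>a\<in>A. \<forall>b. (a, b) \<in> r \<longrightarrow> P (x b)" using a by blast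
    next
      assume "\<exists>a\<in>A. \<forall>b. (a, b) \<in> r \<longrightarrow> P (x b)"
      then obtain a where a: "a \<in> A" "\<And>b. (a, b) \<in> r \<Longrightarrow> P (x b)" by blast
      have "P (snd q)" if q: "((T a, x a), q) \<in> s" for q
      proof -
        have "snd q \<in> T a" using q by (auto simp: s_def B_def)
        then show ?thesis using a(2) by (auto simp: T_def)
      qed
      then show "\<exists>p\<in>B. \<forall>q. (p, q) \<in> s \<longrightarrow> P (snd q)"
        using B_I[OF a(1) T_self[OF a(1)]] by blast
    qed
    then show "eventually P (filtermap snd (tails B s)) \<longleftrightarrow>
        eventually P (filtermap x (tails A r))"
      by (simp add: eventually_filtermap eventually_tails[OF dirB] eventually_tails[OF dir])
  qed
  moreover have "snd ` B \<subseteq> x ` A"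
    using sub by (auto simp: B_def T_def)
  ultimately show ?thesis using dirB that by blast
qed

lemma order_convergentI:
  fixes y :: "'j \<Rightarrow> 'a::vector_lattice"
  assumes dec: "decreases_to B s y 0"
    and dom: "\<And>b\<^sub>0. b\<^sub>0 \<in> B \<Longrightarrow> \<exists>a\<^sub>0\<in>A. \<forall>a. (a\<^sub>0, a) \<in> r \<longrightarrow> \<bar>l - x a\<bar> \<le> y b\<^sub>0"
  shows "order_convergent A r x l"
proof -
  define B' where "B' = {{} :: 'a set} \<times> y ` B"
  define s' where "s' = {(p, q). p \<in> B' \<and> q \<in> B' \<and> snd q \<le> snd p}"
  have dirB: "directed_set B s" and mono: "\<And>b b'. (b, b') \<in> s \<Longrightarrow> y b' \<le> y b"
    and glb: "isGlb UNIV (y ` B) 0"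
    using dec by (auto simp: decreases_to_def)
  have "directed_set B' s'"
    unfolding directed_set_def
  proof (intro conjI ballI)
    show "preorder_on B' s'"
      by (auto simp: preorder_on_def s'_def refl_on_def trans_def)
    show "B' \<noteq> {}" using dirB by (auto simp: B'_def directed_set_def)
    fix p q assume pq: "p \<in> B'" "q \<in> B'"
    then obtain a b where ab: "a \<in> B" "b \<in> B" "snd p = y a" "snd q = y b"
      by (auto simp: B'_def)
    then obtain c where "c \<in> B" "(a, c) \<in> s" "(b, c) \<in> s"
      using dirB unfolding directed_set_def by blast
    then show "\<exists>c\<in>B'. (p, c) \<in> s' \<and> (q, c) \<in> s'"
      using pq ab mono by (intro bexI[of _ "({}, y c)"]) (auto simp: s'_def B'_def)
  qed
  moreover have "snd ` B' = y ` B" by (force simp: B'_def)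
  ultimately have "decreases_to B' s' snd 0"
    using glb by (auto simp: decreases_to_def s'_def)
  moreover have "\<forall>b\<^sub>0\<in>B'. \<exists>a\<^sub>0\<in>A. \<forall>a. (a\<^sub>0, a) \<in> r \<longrightarrow> \<bar>l - x a\<bar> \<le> snd b\<^sub>0"
    using dom by (auto simp: B'_def)
  ultimately show ?thesis unfolding order_convergent_def by blast
qed

lemma order_convergent_iff_eventually:
  fixes x :: "'i \<Rightarrow> 'a::vector_lattice"
  assumes "directed_set A r"
  shows "order_convergent A r x l \<longleftrightarrow>
    (\<exists>(B :: 'a net_index set) s y. decreases_to B s y 0 \<and>
      (\<forall>b\<^sub>0\<in>B. eventually (\<lambda>u. \<bar>l - u\<bar> \<le> y b\<^sub>0) (filtermap x (tails A r))))"
  by (simp add: order_convergent_def eventually_filtermap eventually_tails[OF assms])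

lemma uo_convergent_cong:
  fixes x :: "'i \<Rightarrow> 'a::vector_lattice" and z :: "'j \<Rightarrow> 'a"
  assumes "directed_set A r" "directed_set B s"
    and eq: "filtermap z (tails B s) = filtermap x (tails A r)"
  shows "uo_convergent B s z l \<longleftrightarrow> uo_convergent A r x l"
proof -
  have "filtermap (\<lambda>b. inf \<bar>z b - l\<bar> y) (tails B s) =
      filtermap (\<lambda>a. inf \<bar>x a - l\<bar> y) (tails A r)" for y
    using arg_cong[OF eq, of "filtermap (\<lambda>u. inf \<bar>u - l\<bar> y)"]
    by (simp add: filtermap_filtermap)
  then show ?thesis
    using assms by (simp add: uo_convergent_def order_convergent_iff_eventually)
qed

lemma a_uoI:
  fixes x :: "'i \<Rightarrow> 'a::vector_lattice"
  assumes dir: "directed_set A r" and "x ` A \<subseteq> S" "uo_convergent A r x l"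
  shows "l \<in> a_uo S"
proof -
  obtain B s and z :: "'a net_index \<Rightarrow> 'a" where
    z: "directed_set B s" "z ` B \<subseteq> x ` A" "filtermap z (tails B s) = filtermap x (tails A r)"
    using net_canonical[OF dir] by metis
  have "uo_convergent B s z l"
    using assms uo_convergent_cong[OF dir z(1,3)] by blast
  moreover have "z ` B \<subseteq> S" using z(2) assms(2) by blast
  ultimately show ?thesis using z(1) unfolding a_uo_def by blast
qed

lemma uo_Lebesgue_topologyD:
  fixes x :: "'i \<Rightarrow> 'a::vector_lattice"
  assumes uoL: "uo_Lebesgue_topology T"
    and dir: "directed_set A r" and uo: "uo_convergent A r x 0"
  shows "limitin T x 0 (tails A r)"
proof -
  obtain B s and z :: "'a net_index \<Rightarrow> 'a" where
    z: "directed_set B s" "filtermap z (tails B s) = filtermap x (tails A r)"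
    using net_canonical[OF dir] by metis
  have "uo_convergent B s z 0"
    using uo uo_convergent_cong[OF dir z] by blast
  then have lim: "limitin T z 0 (tails B s)"
    using uoL z(1) unfolding uo_Lebesgue_topology_def by blast
  have "eventually (\<lambda>b. z b \<in> U) (tails B s) \<longleftrightarrow> eventually (\<lambda>a. x a \<in> U) (tails A r)" for U
    using arg_cong[OF z(2), of "eventually (\<lambda>u. u \<in> U)"] by (simp add: eventually_filtermap)
  then show ?thesis using lim by (simp add: limitin_def)
qed

end

theory Submission
  imports Defs
begin

text \<open>
  Two of the inclusions are immediate: a sequence is a net, and a net that is unbounded order
  convergent to \<open>l\<close> converges to \<open>l\<close> in \<open>\<tau>\<close> because \<open>\<tau>\<close> is translation invariant
  and uo-Lebesgue. What remains is to reach every point \<open>l\<close> of the closure by a sequence that is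
  unbounded order convergent.

  For this, call a sequence of solid neighbourhoods of zero halving if
  \<open>U (Suc n) + U (Suc n) \<subseteq> U n\<close>. Suppose that there is a halving sequence whose intersection
  is \<open>{0}\<close>, and pick \<open>x n\<close> in the set with \<open>x n - l \<in> U n\<close>. Truncate by some
  \<open>y \<ge> 0\<close>, so that the tail suprema \<open>w n\<close> of \<open>inf \<bar>x k - l\<bar> y\<close> exist. Finite suprema are
  dominated by finite sums and so lie in the neighbourhoods. Since a directed supremum is an order limit,
  hence a limit in \<open>\<tau>\<close>, the tail suprema lie in neighbourhoods of only slightly smaller
  index. So they decrease to an element of the intersection, which is zero
  (\<open>uo_convergent_halving_sequence\<close>). This is the argument by which a rapidly convergent
  sequence of measurable functions converges almost everywhere.

  A halving sequence with trivial intersection comes from the countable sup property and the weak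
  order unit \<open>e\<close> (\<open>halving_sequence_trivial_kernel\<close>). The intersection of a
  halving sequence is a band; let \<open>t\<close> be the component of \<open>\<bar>e\<bar>\<close> in it. As \<open>\<tau>\<close> is Hausdorff, these
  components have infimum zero when the halving sequence varies, so countably many of
  them already do. A diagonal merge of the corresponding countably many sequences has an
  intersection in which \<open>\<bar>e\<bar>\<close> has component zero, and such a band is trivial because
  all its elements are disjoint from the weak order unit.
\<close>


section \<open>Suprema and disjointness in vector lattices\<close>

lemma isLub_UNIV_iff:
  "isLub UNIV S (s::'a::order) \<longleftrightarrow> (\<forall>x\<in>S. x \<le> s) \<and> (\<forall>u. (\<forall>x\<in>S. x \<le> u) \<longrightarrow> s \<le> u)"
  by (auto simp: isLub_def isUb_def leastP_def setle_def setge_def)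

lemma isGlb_UNIV_iff:
  "isGlb UNIV S (s::'a::order) \<longleftrightarrow> (\<forall>x\<in>S. s \<le> x) \<and> (\<forall>u. (\<forall>x\<in>S. u \<le> x) \<longrightarrow> u \<le> s)"
  by (auto simp: isGlb_def isLb_def greatestP_def setle_def setge_def)

lemma isLub_cSup:
  fixes S :: "'a::conditionally_complete_lattice set"
  assumes "S \<noteq> {}" "bdd_above S"
  shows "isLub UNIV S (Sup S)"
  using assms by (auto simp: isLub_UNIV_iff intro: cSup_upper cSup_least)

text \<open>Expanding the right-hand side by translation invariance gives an infimum of four terms: one
  is \<open>x + y\<close>, and the others are at least \<open>z\<close>.\<close>

lemma inf_add_le:
  fixes x y z :: "'a::lattice_ab_group_add"
  assumes "0 \<le> x" "0 \<le> y" "0 \<le> z"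
  shows "inf (x + y) z \<le> inf x z + inf y z"
proof -
  have "inf x z + inf y z = inf (inf (x + y) (x + z)) (inf (z + y) (z + z))"
    by (simp add: add_inf_distrib_left add_inf_distrib_right inf.assoc inf.left_commute inf.commute)
  moreover have "z \<le> x + z" "z \<le> z + y" "z \<le> z + z"
    using assms by simp_all
  ultimately show ?thesis
    by (auto intro: le_infI2)
qed

text \<open>This is what makes a weak order unit detect nonzero elements: the band generated by an element
  stays inside any disjoint complement that contains the element.\<close>

lemma band_disjoint_complement:
  fixes z :: "'a::vector_lattice"
  assumes "0 \<le> z"
  shows "band {x. inf \<bar>x\<bar> z = 0}"
proof -
  let ?B = "{x. inf \<bar>x\<bar> z = 0}"
  have nonneg: "0 \<le> inf \<bar>x\<bar> z" for x
    using assms by simp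
  have solid: "x \<in> ?B" if "\<bar>x\<bar> \<le> \<bar>y\<bar>" "y \<in> ?B" for x y
  proof -
    have "inf \<bar>x\<bar> z \<le> inf \<bar>y\<bar> z"
      using that(1) by (intro inf_mono) auto
    also have "\<dots> = 0" using that(2) by simp
    finally show ?thesis using nonneg[of x] by (blast intro: antisym)
  qed
  have add: "x + y \<in> ?B" if "x \<in> ?B" "y \<in> ?B" for x y
  proof -
    have "inf \<bar>x + y\<bar> z \<le> inf (\<bar>x\<bar> + \<bar>y\<bar>) z"
      by (intro inf_mono abs_triangle_ineq) auto
    also have "\<dots> \<le> inf \<bar>x\<bar> z + inf \<bar>y\<bar> z"
      using assms by (intro inf_add_le) auto
    also have "\<dots> = 0" using that by simp
    finally show ?thesis using nonneg[of "x + y"] by (blast intro: antisym)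
  qed
  have mult: "real n *\<^sub>R x \<in> ?B" if "x \<in> ?B" for n x
  proof (induction n)
    case 0
    then show ?case using assms by (simp add: inf_absorb1)
  next
    case (Suc n)
    then show ?case using add[OF that] by (simp add: scaleR_left_distrib)
  qed
  have scale: "c *\<^sub>R x \<in> ?B" if "x \<in> ?B" for c x
  proof -
    obtain n :: nat where n: "\<bar>c\<bar> \<le> real n"
      using real_arch_simple by blast
    have upper: "c *\<^sub>R x \<le> real n *\<^sub>R \<bar>x\<bar>" if "\<bar>c\<bar> \<le> real n" for c :: real
    proof -
      have "c *\<^sub>R x = max c 0 *\<^sub>R x + max (-c) 0 *\<^sub>R (- x)"
        by (simp add: max_def)
      also have "\<dots> \<le> max c 0 *\<^sub>R \<bar>x\<bar> + max (-c) 0 *\<^sub>R \<bar>x\<bar>"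
        by (intro add_mono scaleR_left_mono) (auto simp: abs_ge_self abs_ge_minus_self)
      also have "\<dots> = \<bar>c\<bar> *\<^sub>R \<bar>x\<bar>"
        by (simp add: max_def)
      also have "\<dots> \<le> real n *\<^sub>R \<bar>x\<bar>"
        using that by (intro scaleR_right_mono) auto
      finally show ?thesis .
    qed
    have "\<bar>c *\<^sub>R x\<bar> \<le> real n *\<^sub>R \<bar>x\<bar>"
      using upper[of c] upper[of "-c"] n by (intro abs_leI) auto
    moreover have "0 \<le> real n *\<^sub>R \<bar>x\<bar>"
      by (intro scaleR_nonneg_nonneg) auto
    ultimately have "\<bar>c *\<^sub>R x\<bar> \<le> \<bar>real n *\<^sub>R \<bar>x\<bar>\<bar>"
      by simp
    moreover have "real n *\<^sub>R \<bar>x\<bar> \<in> ?B"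
      using mult[of "\<bar>x\<bar>"] that by simp
    ultimately show ?thesis by (rule solid)
  qed
  have closed: "s \<in> ?B" if S: "S \<subseteq> ?B" "S \<noteq> {}" and lub: "isLub UNIV S s" for S s
  proof -
    define u where "u = inf (sup s 0) z"
    have u0: "0 \<le> u" using assms by (simp add: u_def)
    have le_s: "x \<le> s" if "x \<in> S" for x
      using lub that by (auto simp: isLub_UNIV_iff)
    have split: "x = sup x 0 - sup (-x) 0" "\<bar>x\<bar> = sup x 0 + sup (-x) 0" for x :: 'a
    proof -
      have "sup x 0 + - sup (-x) 0 = x"
        using prts[of x] by (simp add: pprt_def nprt_def neg_inf_eq_sup[symmetric] neg_sup_eq_inf)
      then show "x = sup x 0 - sup (-x) 0" by simp
      show "\<bar>x\<bar> = sup x 0 + sup (-x) 0"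
        using abs_prts[of x] by (simp add: pprt_def nprt_def neg_inf_eq_sup)
    qed
    \<comment> \<open>If \<open>u\<close> did not vanish, \<open>s - u\<close> would be a smaller upper bound: the positive part of each
      member of \<open>S\<close> is disjoint from \<open>u\<close>, so it fits below the positive part of \<open>s\<close> beside \<open>u\<close>.\<close>
    have "x \<le> s - u" if "x \<in> S" for x
    proof -
      have "inf (sup x 0) u \<le> inf \<bar>x\<bar> z"
        by (intro inf_mono) (auto simp: u_def abs_ge_self)
      also have "\<dots> = 0" using that S by auto
      finally have "inf (sup x 0) u = 0"
        using u0 by (intro antisym) auto
      then have "sup x 0 + u = sup (sup x 0) u"
        using add_eq_inf_sup[of "sup x 0" u] by simp
      also have "\<dots> \<le> sup s 0"
        using le_s[OF that] by (auto simp: u_def intro: le_supI1)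
      finally have "sup x 0 \<le> sup s 0 - u"
        by (simp add: le_diff_eq)
      moreover have "sup (-s) 0 \<le> sup (-x) 0"
        using le_s[OF that] by (intro sup_mono) auto
      ultimately have "sup x 0 - sup (-x) 0 \<le> sup s 0 - u - sup (-s) 0"
        by (rule diff_mono)
      moreover have "a - u - b = a - b - u" for a b :: 'a
        by simp
      ultimately show ?thesis
        using split(1)[of x] split(1)[of s] by metis
    qed
    then have "s \<le> s - u" using lub by (auto simp: isLub_UNIV_iff)
    then have "u = 0" using u0 by (simp add: le_diff_eq antisym)
    obtain x where x: "x \<in> S" using S by blast
    have "- s \<le> - x" using le_s[OF x] by (simp only: neg_le_iff_le)
    also have "\<dots> \<le> \<bar>x\<bar>" by (rule abs_ge_minus_self)
    finally have "inf (sup (-s) 0) z \<le> inf \<bar>x\<bar> z"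
      by (intro inf_mono) auto
    also have "\<dots> = 0" using S x by auto
    finally have neg: "inf (sup (-s) 0) z \<le> 0" .
    have "inf \<bar>s\<bar> z \<le> inf (sup s 0) z + inf (sup (-s) 0) z"
      unfolding split(2)[of s] using assms by (intro inf_add_le) auto
    also have "\<dots> \<le> 0" using neg \<open>u = 0\<close> by (simp add: u_def)
    finally show ?thesis using nonneg[of s] by (simp add: antisym)
  qed
  have "subspace ?B"
    using add scale assms by (auto simp: subspace_def inf_absorb1)
  moreover have "solid ?B"
    using solid by (auto simp: solid_def)
  ultimately show ?thesis
    using closed by (auto simp: band_def)
qed

lemma weak_order_unit_disjoint:
  fixes e z :: "'a::vector_lattice"
  assumes "weak_order_unit e" "0 \<le> z" "inf \<bar>e\<bar> z = 0"
  shows "z = 0"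
proof -
  have "band hull {e} \<subseteq> {x. inf \<bar>x\<bar> z = 0}"
    using assms by (intro hull_minimal band_disjoint_complement) auto
  then have "inf \<bar>z\<bar> z = 0"
    using assms(1) unfolding weak_order_unit_def by blast
  then show ?thesis using assms(2) by simp
qed


section \<open>Locally solid topologies\<close>

lemma openin_translation:
  assumes "linear_topology T" "openin T W"
  shows "openin T {y. y + a \<in> W}"
proof -
  have top: "topspace T = UNIV"
    and add: "continuous_map (prod_topology T T) T (\<lambda>(x, y). x + y)"
    using assms(1) by (auto simp: linear_topology_def)
  have "continuous_map T (prod_topology T T) (\<lambda>y. (y, a))"
    by (intro continuous_map_pairedI) (auto simp: top)
  from continuous_map_compose[OF this add] have "continuous_map T T (\<lambda>y. y + a)"
    by (simp add: o_def)
  from openin_continuous_map_preimage[OF this assms(2)] show ?thesis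
    by (simp add: top)
qed

definition solid_neighbourhood :: "'a::vector_lattice topology \<Rightarrow> 'a set \<Rightarrow> bool" where
  "solid_neighbourhood T V \<longleftrightarrow> solid V \<and> (\<exists>W. openin T W \<and> 0 \<in> W \<and> W \<subseteq> V)"

lemma solid_neighbourhood_Int:
  assumes "solid_neighbourhood T U" "solid_neighbourhood T V"
  shows "solid_neighbourhood T (U \<inter> V)"
proof -
  obtain W W' where "openin T W" "0 \<in> W" "W \<subseteq> U" "openin T W'" "0 \<in> W'" "W' \<subseteq> V"
    using assms unfolding solid_neighbourhood_def by blast
  then have "openin T (W \<inter> W')" "0 \<in> W \<inter> W'" "W \<inter> W' \<subseteq> U \<inter> V" by auto
  moreover have "solid (U \<inter> V)"
    using assms unfolding solid_neighbourhood_def solid_def by blast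
  ultimately show ?thesis unfolding solid_neighbourhood_def by blast
qed

lemma solid_neighbourhood_INT:
  fixes U :: "nat \<Rightarrow> 'a::vector_lattice set"
  assumes "\<And>k. solid_neighbourhood T (U k)"
  shows "solid_neighbourhood T (\<Inter>k\<le>n. U k)"
  by (induction n) (auto simp: assms atMost_Suc intro: solid_neighbourhood_Int)

lemma solid_neighbourhood_halving:
  assumes "linear_topology T" "locally_solid T" "solid_neighbourhood T U"
  shows "\<exists>V. solid_neighbourhood T V \<and> (\<forall>x\<in>V. \<forall>y\<in>V. x + y \<in> U)"
proof -
  obtain W where W: "openin T W" "0 \<in> W" "W \<subseteq> U"
    using assms(3) by (auto simp: solid_neighbourhood_def)
  have top: "topspace T = UNIV"
    and add: "continuous_map (prod_topology T T) T (\<lambda>(x, y). x + y)"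
    using assms(1) by (auto simp: linear_topology_def)
  have "openin (prod_topology T T) {p. fst p + snd p \<in> W}"
    using openin_continuous_map_preimage[OF add W(1)] by (simp add: top split_def)
  then obtain A B where AB: "openin T A" "openin T B" "0 \<in> A" "0 \<in> B"
      "A \<times> B \<subseteq> {p. fst p + snd p \<in> W}"
    using W(2) unfolding openin_prod_topology_alt
    by (elim allE[of _ 0]) auto
  have "openin T (A \<inter> B)" "0 \<in> A \<inter> B" using AB by auto
  then obtain V W' where V: "openin T W'" "0 \<in> W'" "W' \<subseteq> V" "solid V" "V \<subseteq> A \<inter> B"
    using assms(2) unfolding locally_solid_def by meson
  then have "solid_neighbourhood T V" unfolding solid_neighbourhood_def by blast
  moreover have "x + y \<in> U" if "x \<in> V" "y \<in> V" for x y
  proof -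
    have "(x, y) \<in> A \<times> B" using V(5) that by blast
    then have "x + y \<in> W" using AB(5) by auto
    then show ?thesis using W(3) by blast
  qed
  ultimately show ?thesis by blast
qed

text \<open>These sequences take the place of a Riesz pseudonorm: \<open>U n\<close> acts as the ball of radius
  \<open>2\<^sup>-\<^sup>n\<close>, and the intersection of the sequence as the set on which the pseudonorm vanishes.\<close>

definition halving_sequence :: "'a::vector_lattice topology \<Rightarrow> (nat \<Rightarrow> 'a set) \<Rightarrow> bool" where
  "halving_sequence T U \<longleftrightarrow> (\<forall>n. solid_neighbourhood T (U n)) \<and>
     (\<forall>n. \<forall>x\<in>U (Suc n). \<forall>y\<in>U (Suc n). x + y \<in> U n)"

lemma halving_sequence_exists:
  assumes "linear_topology T" "locally_solid T" "solid_neighbourhood T V"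
  shows "\<exists>U. halving_sequence T U \<and> U 0 = V"
proof -
  have "\<exists>U. \<forall>n. (solid_neighbourhood T (U n) \<and> (n = 0 \<longrightarrow> U n = V)) \<and>
      (\<forall>x\<in>U (Suc n). \<forall>y\<in>U (Suc n). x + y \<in> U n)"
    by (intro dependent_nat_choice)
      (use assms solid_neighbourhood_halving[OF assms(1,2)] in auto)
  then show ?thesis unfolding halving_sequence_def by metis
qed

lemma
  assumes "halving_sequence T U"
  shows halving_sequence_solid: "y \<in> U n \<Longrightarrow> \<bar>x\<bar> \<le> \<bar>y\<bar> \<Longrightarrow> x \<in> U n"
    and halving_sequence_open: "\<exists>W. openin T W \<and> 0 \<in> W \<and> W \<subseteq> U n"
    and halving_sequence_add: "x \<in> U (Suc n) \<Longrightarrow> y \<in> U (Suc n) \<Longrightarrow> x + y \<in> U n"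
    and halving_sequence_zero: "0 \<in> U n"
proof -
  have nbhd: "solid (U n)" "\<exists>W. openin T W \<and> 0 \<in> W \<and> W \<subseteq> U n"
    using assms unfolding halving_sequence_def solid_neighbourhood_def by simp_all
  show "y \<in> U n \<Longrightarrow> \<bar>x\<bar> \<le> \<bar>y\<bar> \<Longrightarrow> x \<in> U n"
    using nbhd(1) unfolding solid_def by blast
  show "\<exists>W. openin T W \<and> 0 \<in> W \<and> W \<subseteq> U n" by fact
  show "x \<in> U (Suc n) \<Longrightarrow> y \<in> U (Suc n) \<Longrightarrow> x + y \<in> U n"
    using assms unfolding halving_sequence_def by simp
  show "0 \<in> U n" using nbhd(2) by blast
qed

lemma halving_sequence_antimono:
  assumes "halving_sequence T U" "m \<le> n"
  shows "U n \<subseteq> U m"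
  using assms(2)
proof (rule lift_Suc_antimono_le[rotated])
  show "U (Suc n) \<subseteq> U n" for n
    using halving_sequence_add[OF assms(1), of _ n 0] halving_sequence_zero[OF assms(1)] by auto
qed

text \<open>The geometric series: the halves spent on the later terms leave the sum within \<open>U n\<close>, however
  many terms there are.\<close>

lemma halving_sequence_sum:
  assumes U: "halving_sequence T U" and v: "\<And>k. v k \<in> U k"
  shows "(\<Sum>k\<in>{Suc n..<Suc n + m}. v k) \<in> U n"
proof (induction m arbitrary: n)
  case 0
  then show ?case using halving_sequence_zero[OF U] by simp
next
  case (Suc m)
  have "(\<Sum>k\<in>{Suc n..<Suc n + Suc m}. v k) = v (Suc n) + (\<Sum>k\<in>{Suc (Suc n)..<Suc (Suc n) + m}. v k)"
    by (subst sum.atLeast_Suc_lessThan) auto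
  then show ?case
    using halving_sequence_add[OF U v Suc.IH] by metis
qed


section \<open>Order continuity of a uo-Lebesgue topology\<close>

text \<open>A set that is directed upwards is itself a net, indexed by its own elements, and
  \<open>t - z\<close> decreases to zero along it. So it is order convergent, a fortiori unbounded order
  convergent, to zero.\<close>

lemma uo_Lebesgue_directed_sup:
  fixes t :: "'a::vector_lattice"
  assumes T: "uo_Lebesgue_topology T" and ne: "D \<noteq> {}"
    and dir: "\<And>a b. a \<in> D \<Longrightarrow> b \<in> D \<Longrightarrow> \<exists>c\<in>D. a \<le> c \<and> b \<le> c"
    and lub: "isLub UNIV D t" and W: "openin T W" "0 \<in> W"
  shows "\<exists>z\<in>D. t - z \<in> W"
proof -
  define r where "r = {(a, b). a \<in> D \<and> b \<in> D \<and> a \<le> b}"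
  have dirD: "directed_set D r"
    using ne dir
    by (fastforce simp: directed_set_def preorder_on_def refl_on_def trans_def r_def)
  have le_t: "z \<le> t" if "z \<in> D" for z
    using lub that by (auto simp: isLub_UNIV_iff)
  have "u \<le> 0" if "\<forall>z\<in>D. u \<le> t - z" for u
  proof -
    have "\<forall>z\<in>D. z \<le> t - u"
      using that by (auto simp: algebra_simps)
    then have "t \<le> t - u"
      using lub unfolding isLub_UNIV_iff by blast
    then show ?thesis by simp
  qed
  then have "isGlb UNIV ((\<lambda>z. t - z) ` D) 0"
    using le_t by (auto simp: isGlb_UNIV_iff)
  then have dec: "decreases_to D r (\<lambda>z. t - z) 0"
    using dirD by (auto simp: decreases_to_def r_def)
  have "uo_convergent D r (\<lambda>z. t - z) 0"
    unfolding uo_convergent_def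
  proof (intro allI impI)
    fix y :: 'a assume "0 \<le> y"
    show "order_convergent D r (\<lambda>a. inf \<bar>t - a - 0\<bar> y) 0"
    proof (rule order_convergentI[OF dec])
      fix b assume b: "b \<in> D"
      have "\<bar>0 - inf \<bar>t - a - 0\<bar> y\<bar> \<le> t - b" if "(b, a) \<in> r" for a
      proof -
        have "\<bar>0 - inf \<bar>t - a - 0\<bar> y\<bar> = inf (t - a) y"
          using that le_t[of a] \<open>0 \<le> y\<close> by (simp add: r_def)
        also have "\<dots> \<le> t - b"
          using that by (auto simp: r_def intro: le_infI1)
        finally show ?thesis .
      qed
      then show "\<exists>a\<^sub>0\<in>D. \<forall>a. (a\<^sub>0, a) \<in> r \<longrightarrow> \<bar>0 - inf \<bar>t - a - 0\<bar> y\<bar> \<le> t - b"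
        using b by blast
    qed
  qed
  then have "limitin T (\<lambda>z. t - z) 0 (tails D r)"
    by (rule uo_Lebesgue_topologyD[OF T dirD])
  then have "eventually (\<lambda>z. t - z \<in> W) (tails D r)"
    using W by (simp add: limitin_def)
  then obtain a where "a \<in> D" "\<forall>b. (a, b) \<in> r \<longrightarrow> t - b \<in> W"
    by (auto simp: eventually_tails[OF dirD])
  then show ?thesis by (auto simp: r_def)
qed

text \<open>The closure of \<open>U (Suc n)\<close> is contained in \<open>U n\<close>; hence directed suprema cost one index.\<close>

lemma halving_sequence_directed_sup:
  fixes t :: "'a::vector_lattice"
  assumes T: "uo_Lebesgue_topology T" and U: "halving_sequence T U" and ne: "D \<noteq> {}"
    and dir: "\<And>a b. a \<in> D \<Longrightarrow> b \<in> D \<Longrightarrow> \<exists>c\<in>D. a \<le> c \<and> b \<le> c"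
    and lub: "isLub UNIV D t" and sub: "D \<subseteq> U (Suc n)"
  shows "t \<in> U n"
proof -
  obtain W where W: "openin T W" "0 \<in> W" "W \<subseteq> U (Suc n)"
    using halving_sequence_open[OF U] by blast
  obtain z where "z \<in> D" "t - z \<in> W"
    using uo_Lebesgue_directed_sup[OF T ne dir lub W(1,2)] by blast
  then have "(t - z) + z \<in> U n"
    using W(3) sub by (intro halving_sequence_add[OF U]) auto
  then show ?thesis by simp
qed


section \<open>A sequence of neighbourhoods with trivial intersection\<close>

text \<open>For a halving sequence \<open>U\<close> and \<open>e \<ge> 0\<close> this is the component of \<open>e\<close> in the band
  \<open>\<Inter>n. U n\<close>, written as a supremum so that neither the band nor its projection has to be
  constructed.\<close>

definition kernel_part :: "'a::{vector_lattice, conditionally_complete_lattice} \<Rightarrow> (nat \<Rightarrow> 'a set) \<Rightarrow> 'a"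
  where "kernel_part e U = Sup {z. 0 \<le> z \<and> z \<le> e \<and> (\<forall>n. z \<in> U n)}"

text \<open>Membership holds because the set in the supremum is directed: a supremum of two of its
  elements is dominated by their sum, and adding only costs one index, which is harmless when all
  indices are allowed.\<close>

lemma
  fixes e :: "'a::{vector_lattice, conditionally_complete_lattice}"
  assumes T: "uo_Lebesgue_topology T" and U: "halving_sequence T U" and e: "0 \<le> e"
  shows kernel_part_mem: "kernel_part e U \<in> U n"
    and kernel_part_nonneg: "0 \<le> kernel_part e U"
    and kernel_part_upper: "0 \<le> z \<Longrightarrow> z \<le> e \<Longrightarrow> (\<And>n. z \<in> U n) \<Longrightarrow> z \<le> kernel_part e U"
proof -
  let ?D = "{z. 0 \<le> z \<and> z \<le> e \<and> (\<forall>n. z \<in> U n)}"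
  have D0: "0 \<in> ?D"
    using e halving_sequence_zero[OF U] by simp
  have bdd: "bdd_above ?D"
    by (auto intro: bdd_aboveI[of _ e])
  have lub: "isLub UNIV ?D (kernel_part e U)"
    unfolding kernel_part_def using D0 bdd by (intro isLub_cSup) auto
  then show "0 \<le> kernel_part e U"
    and "0 \<le> z \<Longrightarrow> z \<le> e \<Longrightarrow> (\<And>n. z \<in> U n) \<Longrightarrow> z \<le> kernel_part e U"
    using D0 by (auto simp: isLub_UNIV_iff)
  have "\<exists>c\<in>?D. a \<le> c \<and> b \<le> c" if "a \<in> ?D" "b \<in> ?D" for a b
  proof (intro bexI[of _ "sup a b"])
    have "sup a b \<in> U n" for n
    proof (rule halving_sequence_solid[OF U])
      show "a + b \<in> U n"
        using that halving_sequence_add[OF U] by blast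
      have "sup a b \<le> a + b" using that by simp
      then show "\<bar>sup a b\<bar> \<le> \<bar>a + b\<bar>"
        using that by (simp add: le_supI1)
    qed
    then show "sup a b \<in> ?D" using that by (auto intro: le_supI1)
  qed auto
  then show "kernel_part e U \<in> U n"
    using D0 by (intro halving_sequence_directed_sup[OF T U _ _ lub]) auto
qed

text \<open>The countable sup property is applied to the negatives of the components of \<open>\<bar>e\<bar>\<close>, to turn
  their infimum into a supremum.\<close>

lemma halving_sequence_trivial_kernel:
  fixes \<tau> :: "'a::{vector_lattice, conditionally_complete_lattice} topology"
  assumes csp: "countable_sup_property TYPE('a)" and unit: "weak_order_unit (e::'a)"
    and T: "uo_Lebesgue_topology \<tau>" and haus: "Hausdorff_space \<tau>"
  shows "\<exists>U. halving_sequence \<tau> U \<and> (\<Inter>n. U n) = {0}"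
proof -
  have lin: "linear_topology \<tau>" and ls: "locally_solid \<tau>" and top: "topspace \<tau> = UNIV"
    using T by (auto simp: uo_Lebesgue_topology_def linear_topology_def)
  have separate: "\<exists>U. halving_sequence \<tau> U \<and> z \<notin> U 0" if "z \<noteq> 0" for z
  proof -
    have "\<exists>W. openin \<tau> W \<and> 0 \<in> W \<and> z \<notin> W"
    proof -
      have "\<exists>W W'. openin \<tau> W \<and> openin \<tau> W' \<and> 0 \<in> W \<and> z \<in> W' \<and> disjnt W W'"
        using haus[unfolded Hausdorff_space_def, rule_format, of 0 z] that by (simp add: top)
      then show ?thesis unfolding disjnt_iff by blast
    qed
    then obtain W where "openin \<tau> W" "0 \<in> W" "z \<notin> W" by blast
    then obtain V where "solid_neighbourhood \<tau> V" "V \<subseteq> W"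
      using ls unfolding locally_solid_def solid_neighbourhood_def by metis
    then show ?thesis
      using halving_sequence_exists[OF lin ls] \<open>z \<notin> W\<close> by blast
  qed
  let ?t = "kernel_part \<bar>e\<bar>"
  note mem = kernel_part_mem[OF T _ abs_ge_zero]
    and nonneg = kernel_part_nonneg[OF T _ abs_ge_zero]
    and upper = kernel_part_upper[OF T _ abs_ge_zero]
  define S where "S = {- ?t U | U. halving_sequence \<tau> U}"
  \<comment> \<open>\<open>- u\<close> is a lower bound of all the parts \<open>?t U\<close>, so its positive part lies in every member of
    every halving sequence and must vanish because the topology is Hausdorff.\<close>
  have "0 \<le> u" if u: "\<forall>x\<in>S. x \<le> u" for u
  proof (rule ccontr)
    assume "\<not> 0 \<le> u"
    then have "sup (- u) 0 \<noteq> 0"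
      by (metis neg_le_0_iff_le sup.cobounded1)
    then obtain U where U: "halving_sequence \<tau> U" "sup (- u) 0 \<notin> U 0"
      using separate by blast
    have "- ?t U \<le> u"
      using u U(1) by (auto simp: S_def)
    then have "sup (- u) 0 \<le> ?t U"
      using nonneg[OF U(1)] by (auto simp: minus_le_iff)
    then have "\<bar>sup (- u) 0\<bar> \<le> \<bar>?t U\<bar>"
      using nonneg[OF U(1)] by simp
    then show False
      using halving_sequence_solid[OF U(1) mem[OF U(1)]] U(2) by blast
  qed
  then have "isLub UNIV S 0"
    using nonneg by (auto simp: isLub_UNIV_iff S_def)
  moreover obtain U\<^sub>0 where "halving_sequence \<tau> U\<^sub>0"
    using halving_sequence_exists[OF lin ls, of UNIV] openin_topspace[of \<tau>]
    by (auto simp: solid_neighbourhood_def solid_def top)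
  then have s0: "- ?t U\<^sub>0 \<in> S" by (auto simp: S_def)
  ultimately obtain C where C: "C \<subseteq> S" "countable C" "isLub UNIV C 0"
    using csp unfolding countable_sup_property_def by blast
  \<comment> \<open>In the trivial lattice \<open>C\<close> may be empty; adjoining one element allows an enumeration of it.\<close>
  define C' where "C' = insert (- ?t U\<^sub>0) C"
  have C': "C' \<subseteq> S" "countable C'" "C' \<noteq> {}"
    using C s0 by (auto simp: C'_def)
  have "\<exists>U. halving_sequence \<tau> U \<and> - ?t U = from_nat_into C' k" for k
    using C' from_nat_into[OF C'(3), of k] by (fastforce simp: S_def)
  then obtain H where H: "\<And>k. halving_sequence \<tau> (H k)" "\<And>k. - ?t (H k) = from_nat_into C' k"
    by metis
  \<comment> \<open>The diagonal merge: each \<open>V n\<close> is a finite intersection, yet \<open>V\<close> is eventually below every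
    \<open>H k\<close>.\<close>
  define V where "V n = (\<Inter>k\<le>n. H k n)" for n
  have V: "halving_sequence \<tau> V"
    unfolding halving_sequence_def
  proof (intro conjI allI ballI)
    show "solid_neighbourhood \<tau> (V n)" for n
      unfolding V_def using H(1)
      by (intro solid_neighbourhood_INT) (auto simp: halving_sequence_def)
    show "x + y \<in> V n" if "x \<in> V (Suc n)" "y \<in> V (Suc n)" for n x y
      using that halving_sequence_add[OF H(1)] by (auto simp: V_def)
  qed
  have V_sub: "z \<in> H k n" if "\<forall>n. z \<in> V n" for z k n
  proof -
    have "z \<in> H k (max k n)" using that[rule_format, of "max k n"] by (auto simp: V_def)
    then show ?thesis using halving_sequence_antimono[OF H(1), of n "max k n"] by auto
  qed
  have "z = 0" if z: "\<forall>n. z \<in> V n" for z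
  proof -
    define w where "w = inf \<bar>e\<bar> \<bar>z\<bar>"
    have w0: "0 \<le> w" by (simp add: w_def)
    have w_mem: "w \<in> V n" for n
      using w0 by (intro halving_sequence_solid[OF V z[rule_format]]) (simp add: w_def)
    have "x \<le> - w" if "x \<in> C" for x
    proof -
      obtain k where "x = from_nat_into C' k"
        using \<open>x \<in> C\<close> C'(2) from_nat_into_surj[of C' x] by (metis C'_def insertCI)
      moreover have "w \<le> ?t (H k)"
        using w0 w_mem by (intro upper[OF H(1)] V_sub) (auto simp: w_def)
      ultimately show ?thesis using H(2)[of k] by (metis neg_le_iff_le)
    qed
    then have "0 \<le> - w" using C(3) unfolding isLub_UNIV_iff by blast
    then have "w = 0" using w0 by (simp add: antisym)
    then have "\<bar>z\<bar> = 0"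
      unfolding w_def by (rule weak_order_unit_disjoint[OF unit abs_ge_zero])
    then show ?thesis by simp
  qed
  then have "(\<Inter>n. V n) = {0}"
    using halving_sequence_zero[OF V] by (intro equalityI subsetI) simp_all
  then show ?thesis using V by (intro exI conjI)
qed


section \<open>From neighbourhoods to unbounded order convergence\<close>

lemma directed_set_nat: "directed_set (UNIV::nat set) {(m, n). m \<le> n}"
  by (auto simp: directed_set_def preorder_on_def refl_on_def trans_def
      intro: max.cobounded1 max.cobounded2)

text \<open>The tail suprema of the truncated distances serve as the dominating sequence. The truncation
  by \<open>y\<close> is what makes them exist.\<close>

lemma uo_convergent_halving_sequence:
  fixes x :: "nat \<Rightarrow> 'a::{vector_lattice, conditionally_complete_lattice}"
  assumes T: "uo_Lebesgue_topology T" and U: "halving_sequence T U"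
    and trivial: "(\<Inter>n. U n) = {0}" and x: "\<And>n. x n - l \<in> U n"
  shows "uo_convergent UNIV {(m, n). m \<le> n} x l"
  unfolding uo_convergent_def
proof (intro allI impI)
  fix y :: 'a assume y: "0 \<le> y"
  define v where "v k = inf \<bar>x k - l\<bar> y" for k
  define w where "w n = Sup (v ` {n..})" for n
  have v0: "0 \<le> v k" and vy: "v k \<le> y" for k
    using y by (auto simp: v_def)
  have vU: "v k \<in> U k" for k
    using v0[of k] by (intro halving_sequence_solid[OF U x]) (simp add: v_def)
  have bdd: "bdd_above (v ` K)" for K
    using vy by (auto intro: bdd_aboveI[of _ y])
  have v_le_w: "v k \<le> w n" if "n \<le> k" for n k
    unfolding w_def using that bdd by (intro cSup_upper) auto
  have w0: "0 \<le> w n" for n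
    using v0[of n] v_le_w[of n n] by (rule order_trans) simp
  have w_anti: "w n \<le> w m" if "m \<le> n" for m n
    unfolding w_def using that bdd by (intro cSup_subset_mono) auto
  \<comment> \<open>Two indices are lost: one to sum the tail, one to pass to the directed supremum.\<close>
  have wU: "w (Suc (Suc n)) \<in> U n" for n
  proof (rule halving_sequence_directed_sup[OF T U])
    let ?p = "\<lambda>m. Sup (v ` {Suc (Suc n)..Suc (Suc n) + m})"
    have p_upper: "v k \<le> ?p m" if "k \<in> {Suc (Suc n)..Suc (Suc n) + m}" for k m
      using that bdd by (intro cSup_upper) auto
    have p_mono: "?p i \<le> ?p j" if "i \<le> j" for i j
      using that bdd by (intro cSup_subset_mono) auto
    show "range ?p \<noteq> {}" by simp
    show "\<exists>c\<in>range ?p. a \<le> c \<and> b \<le> c" if ab: "a \<in> range ?p" "b \<in> range ?p" for a b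
    proof -
      obtain i j where "a = ?p i" "b = ?p j" using ab by blast
      then show ?thesis
        using p_mono[of i "max i j"] p_mono[of j "max i j"] by auto
    qed
    show "isLub UNIV (range ?p) (w (Suc (Suc n)))"
      unfolding isLub_UNIV_iff
    proof (intro conjI ballI allI impI)
      show "a \<le> w (Suc (Suc n))" if "a \<in> range ?p" for a
        using that bdd unfolding w_def by (auto intro!: cSup_subset_mono)
      show "w (Suc (Suc n)) \<le> u" if u: "\<forall>a\<in>range ?p. a \<le> u" for u
        unfolding w_def
      proof (rule cSup_least)
        fix a assume "a \<in> v ` {Suc (Suc n)..}"
        then obtain k where k: "a = v k" "Suc (Suc n) \<le> k" by auto
        then have "a \<le> ?p k" using p_upper[of k k] by auto
        also have "\<dots> \<le> u" using u by blast
        finally show "a \<le> u" .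
      qed simp
    qed
    \<comment> \<open>Solidity reduces finite suprema of positive elements to their sums.\<close>
    show "range ?p \<subseteq> U (Suc n)"
    proof clarify
      fix m
      let ?s = "\<Sum>k\<in>{Suc (Suc n)..<Suc (Suc n) + Suc m}. v k"
      have "?p m \<le> ?s"
      proof (intro cSup_least)
        fix a assume "a \<in> v ` {Suc (Suc n)..Suc (Suc n) + m}"
        then obtain k where "a = v k" "k \<in> {Suc (Suc n)..<Suc (Suc n) + Suc m}" by auto
        then show "a \<le> ?s"
          using v0 sum_mono2[of "{Suc (Suc n)..<Suc (Suc n) + Suc m}" "{k}" v] by simp
      qed simp
      moreover have "0 \<le> ?p m"
        using v0 p_upper[of "Suc (Suc n)" m] by (meson atLeastAtMost_iff le_add1 order_refl order_trans)
      ultimately have "\<bar>?p m\<bar> \<le> \<bar>?s\<bar>" by simp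
      then show "?p m \<in> U (Suc n)"
        using halving_sequence_sum[OF U vU] halving_sequence_solid[OF U] by blast
    qed
  qed
  have "u \<le> 0" if u: "\<forall>n. u \<le> w n" for u
  proof -
    have "sup u 0 \<in> U n" for n
    proof (rule halving_sequence_solid[OF U wU])
      have "sup u 0 \<le> w (Suc (Suc n))" using u w0 by auto
      then show "\<bar>sup u 0\<bar> \<le> \<bar>w (Suc (Suc n))\<bar>" using w0 by simp
    qed
    then have "sup u 0 = 0" using trivial by blast
    then show ?thesis by (metis sup.cobounded1)
  qed
  then have "isGlb UNIV (range w) 0"
    using w0 by (auto simp: isGlb_UNIV_iff)
  moreover have "directed_set (UNIV::nat set) {(m, n). m \<le> n}"
    by (rule directed_set_nat)
  ultimately have "decreases_to UNIV {(m, n). m \<le> n} w 0"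
    using w_anti by (auto simp: decreases_to_def)
  then show "order_convergent UNIV {(m, n). m \<le> n} (\<lambda>a. inf \<bar>x a - l\<bar> y) 0"
  proof (rule order_convergentI)
    fix b :: nat
    have "\<bar>0 - inf \<bar>x a - l\<bar> y\<bar> \<le> w b" if "b \<le> a" for a
      using v0[of a] v_le_w[OF that] by (simp add: v_def)
    then show "\<exists>a\<^sub>0\<in>UNIV. \<forall>a. (a\<^sub>0, a) \<in> {(m, n). m \<le> n} \<longrightarrow> \<bar>0 - inf \<bar>x a - l\<bar> y\<bar> \<le> w b"
      by auto
  qed
qed

lemma a_sigma_uo_subset_a_uo: "a_sigma_uo S \<subseteq> a_uo S"
proof
  fix l assume "l \<in> a_sigma_uo S"
  then obtain x :: "nat \<Rightarrow> 'a" where "range x \<subseteq> S" "uo_convergent UNIV {(m, n). m \<le> n} x l"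
    by (auto simp: a_sigma_uo_def)
  moreover have "directed_set (UNIV::nat set) {(m, n). m \<le> n}"
    by (rule directed_set_nat)
  ultimately show "l \<in> a_uo S" by (intro a_uoI)
qed

lemma a_uo_subset_closure:
  assumes T: "uo_Lebesgue_topology T"
  shows "a_uo S \<subseteq> T closure_of S"
proof
  fix l assume "l \<in> a_uo S"
  then obtain A :: "'a net_index set" and r x
    where dir: "directed_set A r" and x: "x ` A \<subseteq> S" and uo: "uo_convergent A r x l"
    by (auto simp: a_uo_def)
  have lin: "linear_topology T" and top: "topspace T = UNIV"
    using T by (auto simp: uo_Lebesgue_topology_def linear_topology_def)
  have "uo_convergent A r (\<lambda>a. x a - l) 0"
    using uo by (simp add: uo_convergent_def)
  then have lim: "limitin T (\<lambda>a. x a - l) 0 (tails A r)"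
    by (rule uo_Lebesgue_topologyD[OF T dir])
  have "\<exists>y\<in>S. y \<in> W" if W: "l \<in> W" "openin T W" for W
  proof -
    have "0 \<in> {v. v + l \<in> W}" using W(1) by simp
    then have "eventually (\<lambda>a. x a - l \<in> {v. v + l \<in> W}) (tails A r)"
      using lim openin_translation[OF lin W(2), of l] unfolding limitin_def by blast
    then obtain a where a: "a \<in> A" "\<forall>b. (a, b) \<in> r \<longrightarrow> x b \<in> W"
      by (auto simp: eventually_tails[OF dir])
    moreover have "(a, a) \<in> r"
      using dir a(1) by (auto simp: directed_set_def preorder_on_def refl_on_def)
    ultimately show ?thesis using x by blast
  qed
  then show "l \<in> T closure_of S"
    by (auto simp: in_closure_of top)
qed

lemma closure_subset_a_sigma_uo:
  fixes S :: "'a::{vector_lattice, conditionally_complete_lattice} set"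
  assumes T: "uo_Lebesgue_topology T" and U: "halving_sequence T U"
    and trivial: "(\<Inter>n. U n) = {0}"
  shows "T closure_of S \<subseteq> a_sigma_uo S"
proof
  fix l assume l: "l \<in> T closure_of S"
  have lin: "linear_topology T"
    using T by (auto simp: uo_Lebesgue_topology_def)
  have "\<exists>y\<in>S. y - l \<in> U n" for n
  proof -
    obtain W where W: "openin T W" "0 \<in> W" "W \<subseteq> U n"
      using halving_sequence_open[OF U] by blast
    have "openin T {y. y - l \<in> W}"
      using openin_translation[OF lin W(1), of "- l"] by simp
    moreover have "l \<in> {y. y - l \<in> W}" using W(2) by simp
    moreover have "\<exists>y. y \<in> S \<and> y \<in> V" if "openin T V" "l \<in> V" for V
      using l that by (simp add: in_closure_of)
    ultimately have "\<exists>y. y \<in> S \<and> y \<in> {y. y - l \<in> W}" by metis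
    then obtain y where "y \<in> S" "y - l \<in> W" by auto
    then show ?thesis using W(3) by blast
  qed
  then obtain x where x: "\<And>n. x n \<in> S" "\<And>n. x n - l \<in> U n" by metis
  have "range x \<subseteq> S" using x(1) by blast
  moreover have "uo_convergent UNIV {(m, n). m \<le> n} x l"
    using x(2) by (rule uo_convergent_halving_sequence[OF T U trivial])
  ultimately show "l \<in> a_sigma_uo S"
    unfolding a_sigma_uo_def by blast
qed

theorem proposition6p8:
  fixes F :: "'a::{vector_lattice, conditionally_complete_lattice} set"
    and \<tau> :: "'a topology"
  assumes "countable_sup_property TYPE('a)"
    and "\<exists>e::'a. weak_order_unit e"
    and "uo_Lebesgue_topology \<tau>"
    and "Hausdorff_space \<tau>"
    and "vector_sublattice F"
  shows "\<tau> closure_of F = a_sigma_uo F \<and> a_sigma_uo F = a_uo F"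
proof -
  obtain e :: 'a where e: "weak_order_unit e" using assms(2) by blast
  obtain U where "halving_sequence \<tau> U" "(\<Inter>n. U n) = {0}"
    using halving_sequence_trivial_kernel[OF assms(1) e assms(3,4)] by (elim exE conjE)
  then have "\<tau> closure_of F \<subseteq> a_sigma_uo F"
    by (rule closure_subset_a_sigma_uo[OF assms(3)])
  then show ?thesis
    using a_sigma_uo_subset_a_uo[of F] a_uo_subset_closure[OF assms(3), of F] by blast
qed

end
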